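(* Let $1 \le t \le s$ be integers and let $\Gamma$ be a finite alphabet of size $v \ge 1$. A weakly secure $(t,s,v)$-AONT is equivalent to a $(v^s,2s,v)$-array on $\Gamma$ that is unbiased with respect to the following subsets of columns: (1) $\{1,\dots,s\}$; (2) $\{s+1,\dots,2s\}$; (3) $I\cup J$, for all $I\subseteq\{1,\dots,s\}$ with $|I|=t$ and all $J\subseteq\{s+1,\dots,2s\}$ with $|J|=s-t$. Explicitly: (a) Let $A$ be a $(v^s,2s,v)$-array on $\Gamma$ that is unbiased with respect to all the column sets in (1)–(3). Then the rule $\phi(x_1,\dots,x_s)=(x_{s+1},\dots,x_{2s})$ for each row $(x_1,\dots,x_{2s})$ of $A$ defines a function $\phi:\Gamma^s\to\Gamma^s$, and for every random variable $\mathbf{X}=(\mathbf{X}_1,\dots,\mathbf{X}_s)$ on $\Gamma^s$ with $\Pr[\mathbf{X}=\mathbf{x}]>0$ for all $\mathbf{x}\in\Gamma^s$, the random variables $\mathbf{X}_1,\dots,\mathbf{X}_s,\mathbf{Y}_1,\dots,\mathbf{Y}_s$ with $(\mathbf{Y}_1,\dots,\mathbf{Y}_s)=\phi(\mathbf{X})$ define a weakly secure $(t,s,v)$-AONT. (b) Conversely, let $\mathbf{X}_1,\dots,\mathbf{X}_s,\mathbf{Y}_1,\dots,\mathbf{Y}_s$ define a weakly secure $(t,s,v)$-AONT over $\Gamma$, and let $\phi:\Gamma^s\to\Gamma^s$ be the induced function with $(\mathbf{Y}_1,\dots,\mathbf{Y}_s)=\phi(\mathbf{X}_1,\dots,\mathbf{X}_s)$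 almost surely. Then the array representation of $\phi$ is a $(v^s,2s,v)$-array that is unbiased with respect to all the column sets in (1)–(3).
   Context: An $(N,k,v)$-array is an array with $N$ rows and $k$ columns (rows may repeat) whose entries lie in an alphabet $\Gamma$ of size $v$. If the columns are labeled by a set $C$ and $D\subseteq C$, then $A_D$ is the array obtained by deleting all columns not in $D$; $A$ is unbiased with respect to $D$ if the rows of $A_D$ contain every $|D|$-tuple of elements of $\Gamma$ exactly $N/v^{|D|}$ times. The columns of a $(v^s,2s,v)$-array are labeled $1,\dots,2s$. The array representation of $\phi:\Gamma^s\to\Gamma^s$ is the $(v^s,2s,v)$-array having, for each $(x_1,\dots,x_s)\in\Gamma^s$, one row $(x_1,\dots,x_s,y_1,\dots,y_s)$ where $(y_1,\dots,y_s)=\phi(x_1,\dots,x_s)$. Random variables $\mathbf{X}_1,\dots,\mathbf{X}_s$ (inputs) and $\mathbf{Y}_1,\dots,\mathbf{Y}_s$ (outputs) with values in $\Gamma$ are said to define a weakly secure $(t,s,v)$-AONT (all-or-nothing transform) if, with $\mathsf{H}$ denoting Shannon entropy: (i) $\mathsf{H}(\mathbf{Y}_1,\dots,\mathbf{Y}_s\mid\mathbf{X}_1,\dots,\mathbf{X}_s)=0$; (ii) $\mathsf{H}(\mathbf{X}_1,\dots,\mathbf{X}_s\mid\mathbf{Y}_1,\dots,\mathbf{Y}_s)=0$; (iii) given the values of any $s-t$ outputs, any $t$ inputs take on any possible values with non-zero probability, i.e. for all $I,J\subseteq\{1,\dots,s\}$ with $|I|=t$, $|J|=s-t$, and all $\mathbf{u}\in\Gamma^t$,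 $\mathbf{v}\in\Gamma^{s-t}$, $\Pr[(\mathbf{X}_i)_{i\in I}=\mathbf{u}\mid(\mathbf{Y}_j)_{j\in J}=\mathbf{v}]>0$. Standing assumption: every input $s$-tuple in $\Gamma^s$ occurs with non-zero probability (hence, by (i) and (ii), so does every output $s$-tuple). *)

theory Defs
  imports "HOL-Probability.Probability" "HOL-Library.Multiset"
begin

section \<open>Arrays\<close>

text \<open>
  A tuple indexed by a set \<open>D\<close> is an element of \<open>D \<rightarrow>\<^sub>E \<Gamma>\<close>; in particular \<open>\<Gamma>^s\<close> is
  \<open>{1..s} \<rightarrow>\<^sub>E \<Gamma>\<close>. An array with columns \<open>{1..k}\<close> is the multiset of its rows: rows may repeat,
  and their order plays no role.
\<close>

abbreviation words :: "nat \<Rightarrow> 'a set \<Rightarrow> (nat \<Rightarrow> 'a) set" where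
  "words s \<Gamma> \<equiv> {1..s} \<rightarrow>\<^sub>E \<Gamma>"

type_synonym 'a array = "(nat \<Rightarrow> 'a) multiset"

definition is_array :: "nat \<Rightarrow> nat \<Rightarrow> nat \<Rightarrow> 'a set \<Rightarrow> 'a array \<Rightarrow> bool" where
  "is_array N k v \<Gamma> A \<longleftrightarrow>
     finite \<Gamma> \<and> card \<Gamma> = v \<and> size A = N \<and> set_mset A \<subseteq> words k \<Gamma>"

definition keep_columns :: "'a array \<Rightarrow> nat set \<Rightarrow> 'a array" where
  "keep_columns A D = image_mset (\<lambda>r. restrict r D) A"

definition unbiased :: "'a set \<Rightarrow> 'a array \<Rightarrow> nat set \<Rightarrow> bool" where
  "unbiased \<Gamma> A D \<longleftrightarrow>
     (\<forall>u \<in> D \<rightarrow>\<^sub>E \<Gamma>.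
        real (count (keep_columns A D) u) = real (size A) / real (card \<Gamma>) ^ card D)"

definition unbiased_AONT_columns :: "nat \<Rightarrow> nat \<Rightarrow> 'a set \<Rightarrow> 'a array \<Rightarrow> bool" where
  "unbiased_AONT_columns t s \<Gamma> A \<longleftrightarrow>
     unbiased \<Gamma> A {1..s} \<and>
     unbiased \<Gamma> A {s+1..2 * s} \<and>
     (\<forall>I J. I \<subseteq> {1..s} \<and> card I = t \<and> J \<subseteq> {s+1..2 * s} \<and> card J = s - t
        \<longrightarrow> unbiased \<Gamma> A (I \<union> J))"

definition left_half :: "nat \<Rightarrow> (nat \<Rightarrow> 'a) \<Rightarrow> nat \<Rightarrow> 'a" where
  "left_half s r = (\<lambda>i\<in>{1..s}. r i)"

definition right_half :: "nat \<Rightarrow> (nat \<Rightarrow> 'a) \<Rightarrow> nat \<Rightarrow> 'a" where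
  "right_half s r = (\<lambda>j\<in>{1..s}. r (s + j))"

definition join_halves :: "nat \<Rightarrow> (nat \<Rightarrow> 'a) \<Rightarrow> (nat \<Rightarrow> 'a) \<Rightarrow> nat \<Rightarrow> 'a" where
  "join_halves s x y = (\<lambda>c\<in>{1..2 * s}. if c \<le> s then x c else y (c - s))"

definition array_representation ::
    "nat \<Rightarrow> 'a set \<Rightarrow> ((nat \<Rightarrow> 'a) \<Rightarrow> (nat \<Rightarrow> 'a)) \<Rightarrow> 'a array" where
  "array_representation s \<Gamma> \<phi> = image_mset (\<lambda>x. join_halves s x (\<phi> x)) (mset_set (words s \<Gamma>))"


section \<open>All-or-nothing transforms\<close>

definition joint :: "nat set \<Rightarrow> (nat \<Rightarrow> 'w \<Rightarrow> 'a) \<Rightarrow> 'w \<Rightarrow> nat \<Rightarrow> 'a" where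
  "joint D X \<omega> = (\<lambda>i\<in>D. X i \<omega>)"

definition random_word :: "'w measure \<Rightarrow> nat \<Rightarrow> 'a set \<Rightarrow> (nat \<Rightarrow> 'w \<Rightarrow> 'a) \<Rightarrow> bool" where
  "random_word M s \<Gamma> X \<longleftrightarrow> (\<forall>i\<in>{1..s}. X i \<in> measurable M (count_space \<Gamma>))"

definition full_support :: "'w measure \<Rightarrow> nat \<Rightarrow> 'a set \<Rightarrow> (nat \<Rightarrow> 'w \<Rightarrow> 'a) \<Rightarrow> bool" where
  "full_support M s \<Gamma> X \<longleftrightarrow> (\<forall>x \<in> words s \<Gamma>. \<P>(\<omega> in M. joint {1..s} X \<omega> = x) > 0)"

text \<open>
  The conditional entropy \<open>H(U | V)\<close> in bits of discrete random variables; this is the library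
  notation \<open>\<H>(U | V)\<close> of the locale \<open>information_space\<close> with base 2.
\<close>

definition cond_entropy :: "'w measure \<Rightarrow> ('w \<Rightarrow> 'b) \<Rightarrow> ('w \<Rightarrow> 'c) \<Rightarrow> real" where
  "cond_entropy M U V =
     prob_space.conditional_entropy M 2
       (count_space (U ` space M)) (count_space (V ` space M)) U V"

text \<open>
  The parameter \<open>v\<close> of a weakly secure \<open>(t,s,v)\<close>-AONT is \<open>card \<Gamma>\<close>. A conditional
  probability given a null event is \<open>0\<close> in the library, so the last clause also demands that each
  conditioning event has positive probability; if the inputs have full support this
  already follows from the two entropy conditions.
\<close>

definition weakly_secure_AONT ::
    "nat \<Rightarrow> nat \<Rightarrow> 'a set \<Rightarrow> 'w measure \<Rightarrow> (nat \<Rightarrow> 'w \<Rightarrow> 'a) \<Rightarrow> (nat \<Rightarrow> 'w \<Rightarrow> 'a) \<Rightarrow> bool" where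
  "weakly_secure_AONT t s \<Gamma> M X Y \<longleftrightarrow>
     prob_space M \<and> random_word M s \<Gamma> X \<and> random_word M s \<Gamma> Y \<and>
     cond_entropy M (joint {1..s} Y) (joint {1..s} X) = 0 \<and>
     cond_entropy M (joint {1..s} X) (joint {1..s} Y) = 0 \<and>
     (\<forall>I J. I \<subseteq> {1..s} \<and> J \<subseteq> {1..s} \<and> card I = t \<and> card J = s - t \<longrightarrow>
        (\<forall>u \<in> I \<rightarrow>\<^sub>E \<Gamma>. \<forall>w \<in> J \<rightarrow>\<^sub>E \<Gamma>.
           \<P>(\<omega> in M. joint I X \<omega> = u \<bar> joint J Y \<omega> = w) > 0))"

end

theory Submission
  imports Defs
begin

text \<open>
  Both sides of the equivalence are statements about one function \<open>\<phi>\<close> on \<open>\<Gamma>^s\<close>, and both say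
  that \<open>\<phi>\<close> is an all-or-nothing map (\<open>AONT_map\<close> below): a bijection for which every choice of
  \<open>t\<close> input values and \<open>s - t\<close> output values is attained by some input word.

  On the array side the point is that every column set in question has exactly \<open>s\<close> columns, while
  the array has \<open>v^s\<close> rows. Unbiased therefore means that each of the \<open>v^s\<close> possible tuples occurs
  exactly once. For the left half this says that the rows form the graph of a function, for the
  right half that this function is injective, and for \<open>I \<union> J\<close> that every prescription is attained
  (\<open>ex1_row_if_unbiased\<close>). Conversely, a map from the \<open>v^s\<close> input words to \<open>v^s\<close> tuples that
  hits every tuple hits each of them exactly once, so it suffices that all tuples are attained
  (\<open>unbiased_image_mset_set\<close>).

  On the probabilistic side, the conditional entropy \<open>H(U | V)\<close> of finitely valued variables
  vanishes exactly if \<open>U\<close> is almost surely a function of \<open>V\<close> (\<open>cond_entropy_eq_0_iff\<close>). Since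
  every input word has positive probability, an almost sure property of the inputs holds for every
  word (\<open>full_support_AE_imp_all\<close>). So the two entropy conditions provide \<open>\<phi>\<close> and its inverse, and
  a combination of inputs and outputs has positive probability exactly if some word attains it.
\<close>

section \<open>All-or-nothing maps\<close>

definition AONT_map ::
    "nat \<Rightarrow> nat \<Rightarrow> 'a set \<Rightarrow> ((nat \<Rightarrow> 'a) \<Rightarrow> nat \<Rightarrow> 'a) \<Rightarrow> bool" where
  "AONT_map t s \<Gamma> \<phi> \<longleftrightarrow>
     bij_betw \<phi> (words s \<Gamma>) (words s \<Gamma>) \<and>
     (\<forall>I J. I \<subseteq> {1..s} \<and> J \<subseteq> {1..s} \<and> card I = t \<and> card J = s - t \<longrightarrow>
        (\<forall>u \<in> I \<rightarrow>\<^sub>E \<Gamma>. \<forall>w \<in> J \<rightarrow>\<^sub>E \<Gamma>.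
           \<exists>x \<in> words s \<Gamma>. restrict x I = u \<and> restrict (\<phi> x) J = w))"

section \<open>Vanishing conditional entropy\<close>

text \<open>
  With \<open>p\<close> the joint distribution and \<open>q\<close> that of \<open>V\<close>, the entropy is the sum of the terms
  \<open>- p(x,y) log (p(x,y) / q(y))\<close>. As \<open>p(x,y) \<le> q(y)\<close>, no term is negative, so the sum vanishes
  only if every pair has \<open>p(x,y) = 0\<close> or \<open>p(x,y) = q(y)\<close>. The latter says that \<open>V = y\<close> forces
  \<open>U = x\<close> almost surely.
\<close>

lemma cond_entropy_eq_0_iff:
  assumes M: "prob_space M" and U: "simple_function M U" and V: "simple_function M V"
  shows "cond_entropy M U V = 0 \<longleftrightarrow> (\<exists>f. AE \<omega> in M. U \<omega> = f (V \<omega>))"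
proof -
  interpret information_space M 2
    using M by (simp add: information_space_def information_space_axioms_def)
  define p where "p z = \<P>(\<omega> in M. U \<omega> = fst z \<and> V \<omega> = snd z)" for z
  define q where "q y = \<P>(\<omega> in M. V \<omega> = y)" for y
  have [measurable]: "U \<in> measurable M (count_space UNIV)" "V \<in> measurable M (count_space UNIV)"
    using U V by (auto intro: measurable_simple_function)
  have le: "p (x, y) \<le> q y" for x y
    unfolding p_def q_def by (intro finite_measure_mono) auto
  have UV: "simple_function M (\<lambda>\<omega>. (U \<omega>, V \<omega>))"
    using U V by (rule simple_function_Pair)
  then have fin: "finite ((\<lambda>\<omega>. (U \<omega>, V \<omega>)) ` space M)"
    by (rule simple_functionD)
  have V_dist: "simple_distributed M V q"
    by (rule simple_distributedI[OF V]) (auto simp: q_def intro!: arg_cong[where f="measure M"])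
  have UV_dist: "simple_distributed M (\<lambda>\<omega>. (U \<omega>, V \<omega>)) p"
    by (rule simple_distributedI[OF UV]) (auto simp: p_def intro!: arg_cong[where f="measure M"])
  have p0: "0 \<le> p z" for z by (simp add: p_def)
  have term_nonpos: "p (x, y) * log 2 (p (x, y) / q y) \<le> 0" for x y
  proof (cases "p (x, y) = 0")
    case False
    then have "0 < p (x, y)" using p0[of "(x, y)"] by linarith
    then have "log 2 (p (x, y) / q y) \<le> 0" using le[of x y] by (simp add: log_le_zero_cancel_iff)
    then show ?thesis using p0 by (simp add: mult_nonneg_nonpos)
  qed simp
  have term_0: "p (x, y) * log 2 (p (x, y) / q y) = 0 \<longleftrightarrow> p (x, y) = 0 \<or> p (x, y) = q y" for x y
  proof (cases "p (x, y) = 0")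
    case False
    then have "0 < p (x, y)" using p0[of "(x, y)"] by linarith
    then show ?thesis using le[of x y] by (auto simp: log_def)
  qed simp
  have "cond_entropy M U V =
      - (\<Sum>(x, y)\<in>(\<lambda>\<omega>. (U \<omega>, V \<omega>)) ` space M. p (x, y) * log 2 (p (x, y) / q y))"
    unfolding cond_entropy_def by (rule conditional_entropy_eq[OF V_dist UV_dist])
  also have "\<dots> = 0 \<longleftrightarrow> (\<forall>(x, y)\<in>(\<lambda>\<omega>. (U \<omega>, V \<omega>)) ` space M.
      p (x, y) * log 2 (p (x, y) / q y) = 0)"
    unfolding sum_negf[symmetric] using fin term_nonpos
    by (subst sum_nonneg_eq_0_iff) auto
  also have "\<dots> \<longleftrightarrow> (\<forall>(x, y)\<in>(\<lambda>\<omega>. (U \<omega>, V \<omega>)) ` space M. p (x, y) = 0 \<or> p (x, y) = q y)"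
    unfolding term_0 ..
  also have "\<dots> \<longleftrightarrow> (\<exists>f. AE \<omega> in M. U \<omega> = f (V \<omega>))"
  proof
    assume *: "\<forall>(x, y)\<in>(\<lambda>\<omega>. (U \<omega>, V \<omega>)) ` space M. p (x, y) = 0 \<or> p (x, y) = q y"
    \<comment> \<open>For every \<open>y\<close> that \<open>V\<close> takes with positive probability there is exactly one such \<open>x\<close>.\<close>
    define f where "f y = (SOME x. 0 < p (x, y))" for y
    have "AE \<omega> in M. p (U \<omega>, V \<omega>) \<noteq> 0"
    proof -
      have "AE \<omega> in M. \<forall>z\<in>(\<lambda>\<omega>. (U \<omega>, V \<omega>)) ` space M.
          p z = 0 \<longrightarrow> \<not> (U \<omega> = fst z \<and> V \<omega> = snd z)"
        using fin
      proof (rule AE_finite_allI)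
        fix z
        have "(AE \<omega> in M. \<not> (U \<omega> = fst z \<and> V \<omega> = snd z))" if "p z = 0"
          using that unfolding p_def by (subst (asm) prob_eq_0) auto
        then show "AE \<omega> in M. p z = 0 \<longrightarrow> \<not> (U \<omega> = fst z \<and> V \<omega> = snd z)"
          by auto
      qed
      then show ?thesis using AE_space by eventually_elim auto
    qed
    moreover have "AE \<omega> in M. \<forall>z\<in>(\<lambda>\<omega>. (U \<omega>, V \<omega>)) ` space M.
        p z = q (snd z) \<longrightarrow> V \<omega> = snd z \<longrightarrow> U \<omega> = fst z"
    proof (intro AE_finite_allI[OF fin])
      fix z assume "z \<in> (\<lambda>\<omega>. (U \<omega>, V \<omega>)) ` space M"
      have "p z = q (snd z) \<Longrightarrow> \<P>(\<omega> in M. V \<omega> = snd z \<and> U \<omega> \<noteq> fst z) = 0"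
      proof -
        assume "p z = q (snd z)"
        moreover have "q (snd z) = p z + \<P>(\<omega> in M. V \<omega> = snd z \<and> U \<omega> \<noteq> fst z)"
          unfolding p_def q_def
          by (subst finite_measure_Union[symmetric])
             (auto intro!: arg_cong[where f="measure M"])
        ultimately show ?thesis by simp
      qed
      then have "AE \<omega> in M. \<not> (V \<omega> = snd z \<and> U \<omega> \<noteq> fst z)" if "p z = q (snd z)"
        using that by (subst (asm) prob_eq_0) auto
      then show "AE \<omega> in M. p z = q (snd z) \<longrightarrow> V \<omega> = snd z \<longrightarrow> U \<omega> = fst z"
        by (cases "p z = q (snd z)") auto
    qed
    ultimately have "AE \<omega> in M. U \<omega> = f (V \<omega>)"
      using AE_space
    proof eventually_elim
      case (elim \<omega>)
      then have "0 < p (U \<omega>, V \<omega>)" using p0[of "(U \<omega>, V \<omega>)"] by linarith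
      then have "0 < p (f (V \<omega>), V \<omega>)" unfolding f_def by (rule someI)
      then have "{\<omega>' \<in> space M. U \<omega>' = f (V \<omega>) \<and> V \<omega>' = V \<omega>} \<noteq> {}"
        unfolding p_def fst_conv snd_conv by (metis less_irrefl measure_empty)
      then obtain \<omega>' where \<omega>': "\<omega>' \<in> space M" "U \<omega>' = f (V \<omega>)" "V \<omega>' = V \<omega>"
        by blast
      then have "p (U \<omega>', V \<omega>') = q (V \<omega>')"
        using * \<open>0 < p (f (V \<omega>), V \<omega>)\<close> by force
      with \<omega>' elim show ?case by force
    qed
    then show "\<exists>f. AE \<omega> in M. U \<omega> = f (V \<omega>)" by blast
  next
    assume "\<exists>f. AE \<omega> in M. U \<omega> = f (V \<omega>)"
    then obtain f where f: "AE \<omega> in M. U \<omega> = f (V \<omega>)" by blast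
    have "p (x, y) = 0 \<or> p (x, y) = q y" for x y
    proof (cases "x = f y")
      case True
      have "p (x, y) = q y" unfolding p_def q_def
        using f by (intro finite_measure_eq_AE) (auto simp: True)
      then show ?thesis ..
    next
      case False
      have "p (x, y) = 0" unfolding p_def
        using f False by (subst prob_eq_0) auto
      then show ?thesis ..
    qed
    then show "\<forall>(x, y)\<in>(\<lambda>\<omega>. (U \<omega>, V \<omega>)) ` space M. p (x, y) = 0 \<or> p (x, y) = q y"
      by blast
  qed
  finally show ?thesis .
qed

section \<open>Weak security and all-or-nothing maps\<close>

lemma sets_simple_function_Pair:
  assumes "simple_function M f" "simple_function M g"
  shows "{\<omega> \<in> space M. P (f \<omega>) (g \<omega>)} \<in> sets M"
  using measurable_sets[OF measurable_simple_function[OF simple_function_Pair[OF assms]],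
      of "{(x, y). P x y}"]
  by (simp add: vimage_def Int_def conj_commute)

lemma joint_in_PiE:
  assumes "random_word M s \<Gamma> X" "D \<subseteq> {1..s}" "\<omega> \<in> space M"
  shows "joint D X \<omega> \<in> D \<rightarrow>\<^sub>E \<Gamma>"
  using assms by (auto simp: random_word_def joint_def dest!: measurable_space)

lemma restrict_joint: "D \<subseteq> E \<Longrightarrow> restrict (joint E X \<omega>) D = joint D X \<omega>"
  by (auto simp: joint_def fun_eq_iff)

lemma simple_function_joint:
  assumes "finite \<Gamma>" and X: "random_word M s \<Gamma> X"
  shows "simple_function M (joint {1..s} X)"
  unfolding simple_function_def
proof (intro conjI ballI)
  have "joint {1..s} X ` space M \<subseteq> words s \<Gamma>"
    using joint_in_PiE[OF X] by blast
  then show "finite (joint {1..s} X ` space M)"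
    by (rule finite_subset) (simp add: finite_PiE \<open>finite \<Gamma>\<close>)
next
  fix x assume "x \<in> joint {1..s} X ` space M"
  then have x: "x \<in> words s \<Gamma>" using joint_in_PiE[OF X] by blast
  have [measurable]: "X i \<in> measurable M (count_space \<Gamma>)" if "i \<in> {1..s}" for i
    using X that by (simp add: random_word_def)
  have "joint {1..s} X -` {x} \<inter> space M = {\<omega> \<in> space M. \<forall>i\<in>{1..s}. X i \<omega> = x i}"
    using x by (auto simp: joint_def fun_eq_iff PiE_def extensional_def restrict_def split: if_splits)
  also have "\<dots> \<in> sets M"
  proof (intro sets.sets_Collect_finite_All)
    fix i assume i: "i \<in> {1..s}"
    have "X i -` {x i} \<inter> space M \<in> sets M"
      using i x by (intro measurable_sets[of _ _ "count_space \<Gamma>"]) auto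
    then show "{\<omega> \<in> space M. X i \<omega> = x i} \<in> sets M"
      by (simp add: vimage_def Int_def conj_commute)
  qed simp
  finally show "joint {1..s} X -` {x} \<inter> space M \<in> sets M" .
qed

lemma full_support_AE_imp_all:
  assumes "prob_space M" and "full_support M s \<Gamma> X"
    and Q: "AE \<omega> in M. Q (joint {1..s} X \<omega>)" and x: "x \<in> words s \<Gamma>"
  shows "Q x"
proof (rule ccontr)
  interpret prob_space M by fact
  assume "\<not> Q x"
  with Q have "AE \<omega> in M. \<not> joint {1..s} X \<omega> = x"
    by auto
  then have "\<P>(\<omega> in M. joint {1..s} X \<omega> = x) = 0"
    by (rule prob_eq_0_AE)
  with assms(2) x show False by (auto simp: full_support_def)
qed

text \<open>
  The event that \<open>t\<close> inputs and \<open>s - t\<close> outputs take given values contains the event that the input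
  is a word attaining these values, which has positive probability. This also makes the
  conditioning event non-null.
\<close>

lemma weakly_secure_AONT_if_AONT_map:
  assumes "finite \<Gamma>" and M: "prob_space M" and X: "random_word M s \<Gamma> X"
    and supp: "full_support M s \<Gamma> X" and \<phi>: "AONT_map t s \<Gamma> \<phi>"
    and Y: "\<And>\<omega>. \<omega> \<in> space M \<Longrightarrow> joint {1..s} Y \<omega> = \<phi> (joint {1..s} X \<omega>)"
  shows "weakly_secure_AONT t s \<Gamma> M X Y"
proof -
  interpret prob_space M by fact
  have sX: "simple_function M (joint {1..s} X)"
    by (rule simple_function_joint) fact+
  have bij: "bij_betw \<phi> (words s \<Gamma>) (words s \<Gamma>)"
    using \<phi> by (simp add: AONT_map_def)
  have X_in: "joint {1..s} X \<omega> \<in> words s \<Gamma>" if "\<omega> \<in> space M" for \<omega>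
    using joint_in_PiE[OF X _ that] by blast
  have Y_eq: "Y i \<omega> = \<phi> (joint {1..s} X \<omega>) i" if "\<omega> \<in> space M" "i \<in> {1..s}" for i \<omega>
    using fun_cong[OF Y[OF that(1)], of i] that(2) by (simp add: joint_def)
  have rY: "random_word M s \<Gamma> Y"
    unfolding random_word_def
  proof
    fix i assume i: "i \<in> {1..s}"
    have "\<phi> (joint {1..s} X \<omega>) i \<in> \<Gamma>" if "\<omega> \<in> space M" for \<omega>
      using bij_betwE[OF bij] X_in[OF that] i by blast
    moreover have "(\<lambda>\<omega>. \<phi> (joint {1..s} X \<omega>) i) \<in> measurable M (count_space UNIV)"
      by (rule measurable_compose[OF measurable_simple_function[OF sX]]) simp
    ultimately have "(\<lambda>\<omega>. \<phi> (joint {1..s} X \<omega>) i) \<in> measurable M (count_space \<Gamma>)"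
      using \<open>finite \<Gamma>\<close> by (auto simp: measurable_count_space_eq2 intro: measurable_sets)
    then show "Y i \<in> measurable M (count_space \<Gamma>)"
      by (rule measurable_cong[THEN iffD1, rotated]) (use Y_eq[OF _ i] in simp)
  qed
  have sY: "simple_function M (joint {1..s} Y)"
    by (rule simple_function_joint) fact+
  have "cond_entropy M (joint {1..s} Y) (joint {1..s} X) = 0"
    unfolding cond_entropy_eq_0_iff[OF M sY sX] using Y by blast
  moreover have "cond_entropy M (joint {1..s} X) (joint {1..s} Y) = 0"
    unfolding cond_entropy_eq_0_iff[OF M sX sY]
  proof
    show "AE \<omega> in M. joint {1..s} X \<omega> = inv_into (words s \<Gamma>) \<phi> (joint {1..s} Y \<omega>)"
      using bij_betw_inv_into_left[OF bij X_in] by (intro AE_I2) (metis Y)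
  qed
  moreover have "0 < \<P>(\<omega> in M. joint I X \<omega> = u \<bar> joint J Y \<omega> = w)"
    if I: "I \<subseteq> {1..s}" and J: "J \<subseteq> {1..s}" and "card I = t" "card J = s - t"
      and "u \<in> I \<rightarrow>\<^sub>E \<Gamma>" "w \<in> J \<rightarrow>\<^sub>E \<Gamma>" for I J u w
  proof -
    obtain x where x: "x \<in> words s \<Gamma>" "restrict x I = u" "restrict (\<phi> x) J = w"
      using \<phi> \<open>card I = t\<close> \<open>card J = s - t\<close> I J \<open>u \<in> I \<rightarrow>\<^sub>E \<Gamma>\<close> \<open>w \<in> J \<rightarrow>\<^sub>E \<Gamma>\<close>
      unfolding AONT_map_def by metis
    have *: "joint I X = (\<lambda>\<omega>. restrict (joint {1..s} X \<omega>) I)"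
      "joint J Y = (\<lambda>\<omega>. restrict (joint {1..s} Y \<omega>) J)"
      using I J by (simp_all add: fun_eq_iff restrict_joint)
    have "0 < \<P>(\<omega> in M. joint {1..s} X \<omega> = x)"
      using supp x by (simp add: full_support_def)
    also have "\<dots> \<le> \<P>(\<omega> in M. joint I X \<omega> = u \<and> joint J Y \<omega> = w)"
    proof (rule finite_measure_mono)
      have "joint I X \<omega> = u \<and> joint J Y \<omega> = w"
        if "\<omega> \<in> space M" "joint {1..s} X \<omega> = x" for \<omega>
        using x that Y[OF that(1)] by (simp add: *)
      then show "{\<omega> \<in> space M. joint {1..s} X \<omega> = x}
          \<subseteq> {\<omega> \<in> space M. joint I X \<omega> = u \<and> joint J Y \<omega> = w}"
        by blast
      show "{\<omega> \<in> space M. joint I X \<omega> = u \<and> joint J Y \<omega> = w} \<in> sets M"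
        unfolding * by (rule sets_simple_function_Pair[OF sX sY])
    qed
    finally have "0 < \<P>(\<omega> in M. joint I X \<omega> = u \<and> joint J Y \<omega> = w)" .
    moreover have "\<dots> \<le> \<P>(\<omega> in M. joint J Y \<omega> = w)"
      unfolding * by (intro finite_measure_mono sets_simple_function_Pair[OF sX sY]) auto
    ultimately show ?thesis unfolding cond_prob_def by auto
  qed
  ultimately show ?thesis
    unfolding weakly_secure_AONT_def using M X rY by blast
qed

text \<open>
  The entropy of the inputs given the outputs yields an almost sure left inverse of \<open>\<phi>\<close>, which by
  full support inverts \<open>\<phi>\<close> on all words. A combination of values attained by no word would be a
  null event.
\<close>

lemma AONT_map_if_weakly_secure_AONT:
  assumes "finite \<Gamma>" and aont: "weakly_secure_AONT t s \<Gamma> M X Y"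
    and supp: "full_support M s \<Gamma> X" and \<phi>: "\<phi> \<in> words s \<Gamma> \<rightarrow> words s \<Gamma>"
    and Y: "AE \<omega> in M. joint {1..s} Y \<omega> = \<phi> (joint {1..s} X \<omega>)"
  shows "AONT_map t s \<Gamma> \<phi>"
proof -
  have M: "prob_space M" and X: "random_word M s \<Gamma> X" and rY: "random_word M s \<Gamma> Y"
    and H: "cond_entropy M (joint {1..s} X) (joint {1..s} Y) = 0"
    using aont by (auto simp: weakly_secure_AONT_def)
  interpret prob_space M by fact
  have sX: "simple_function M (joint {1..s} X)" and sY: "simple_function M (joint {1..s} Y)"
    by (rule simple_function_joint[OF \<open>finite \<Gamma>\<close>], fact)+
  obtain \<psi> where "AE \<omega> in M. joint {1..s} X \<omega> = \<psi> (joint {1..s} Y \<omega>)"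
    using H unfolding cond_entropy_eq_0_iff[OF M sX sY] by blast
  with Y have "AE \<omega> in M. \<psi> (\<phi> (joint {1..s} X \<omega>)) = joint {1..s} X \<omega>"
    by eventually_elim simp
  then have "\<psi> (\<phi> x) = x" if "x \<in> words s \<Gamma>" for x
    by (rule full_support_AE_imp_all[OF M supp, where Q = "\<lambda>x. \<psi> (\<phi> x) = x"]) fact+
  then have "inj_on \<phi> (words s \<Gamma>)" by (rule inj_on_inverseI[where g = \<psi>])
  moreover from this have "\<phi> ` words s \<Gamma> = words s \<Gamma>"
    using \<phi> \<open>finite \<Gamma>\<close> by (intro endo_inj_surj) (auto simp: finite_PiE)
  ultimately have "bij_betw \<phi> (words s \<Gamma>) (words s \<Gamma>)" by (simp add: bij_betw_def)
  moreover have "\<exists>x \<in> words s \<Gamma>. restrict x I = u \<and> restrict (\<phi> x) J = w"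
    if I: "I \<subseteq> {1..s}" and J: "J \<subseteq> {1..s}" and "card I = t" "card J = s - t"
      and "u \<in> I \<rightarrow>\<^sub>E \<Gamma>" "w \<in> J \<rightarrow>\<^sub>E \<Gamma>" for I J u w
  proof (rule ccontr)
    assume no: "\<not> ?thesis"
    have *: "joint I X = (\<lambda>\<omega>. restrict (joint {1..s} X \<omega>) I)"
      "joint J Y = (\<lambda>\<omega>. restrict (joint {1..s} Y \<omega>) J)"
      using I J by (simp_all add: fun_eq_iff restrict_joint)
    have "AE \<omega> in M. \<not> (joint I X \<omega> = u \<and> joint J Y \<omega> = w)"
      using Y AE_space
    proof eventually_elim
      case (elim \<omega>)
      then show ?case using no joint_in_PiE[OF X order_refl elim(2)] by (auto simp: *)
    qed
    then have "\<P>(\<omega> in M. joint I X \<omega> = u \<and> joint J Y \<omega> = w) = 0"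
      by (rule prob_eq_0_AE)
    moreover have "0 < \<P>(\<omega> in M. joint I X \<omega> = u \<bar> joint J Y \<omega> = w)"
      using aont that unfolding weakly_secure_AONT_def by blast
    ultimately show False by (simp add: cond_prob_def)
  qed
  ultimately show ?thesis unfolding AONT_map_def by blast
qed

text \<open>
  The entropy of the outputs given the inputs provides the function; two candidates agree almost
  surely on the inputs, hence by full support on every word.
\<close>

lemma ex1_induced_map:
  assumes "finite \<Gamma>" and aont: "weakly_secure_AONT t s \<Gamma> M X Y"
    and supp: "full_support M s \<Gamma> X"
  shows "\<exists>!\<phi>. \<phi> \<in> words s \<Gamma> \<rightarrow>\<^sub>E words s \<Gamma> \<and>
    (AE \<omega> in M. joint {1..s} Y \<omega> = \<phi> (joint {1..s} X \<omega>))"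
proof -
  have M: "prob_space M" and X: "random_word M s \<Gamma> X" and rY: "random_word M s \<Gamma> Y"
    and H: "cond_entropy M (joint {1..s} Y) (joint {1..s} X) = 0"
    using aont by (auto simp: weakly_secure_AONT_def)
  have sX: "simple_function M (joint {1..s} X)" and sY: "simple_function M (joint {1..s} Y)"
    by (rule simple_function_joint[OF \<open>finite \<Gamma>\<close>], fact)+
  obtain f where f: "AE \<omega> in M. joint {1..s} Y \<omega> = f (joint {1..s} X \<omega>)"
    using H unfolding cond_entropy_eq_0_iff[OF M sY sX] by blast
  then have "AE \<omega> in M. f (joint {1..s} X \<omega>) \<in> words s \<Gamma>"
    using AE_space by eventually_elim (use joint_in_PiE[OF rY order_refl] in metis)
  then have f_in: "f x \<in> words s \<Gamma>" if "x \<in> words s \<Gamma>" for x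
    by (rule full_support_AE_imp_all[OF M supp, where Q = "\<lambda>x. f x \<in> words s \<Gamma>"]) fact+
  show ?thesis
  proof (rule ex1I[of _ "restrict f (words s \<Gamma>)"], intro conjI)
    show "restrict f (words s \<Gamma>) \<in> words s \<Gamma> \<rightarrow>\<^sub>E words s \<Gamma>"
      using f_in by (simp add: restrict_PiE_iff)
    show "AE \<omega> in M. joint {1..s} Y \<omega> = restrict f (words s \<Gamma>) (joint {1..s} X \<omega>)"
      using f AE_space
      by eventually_elim (use joint_in_PiE[OF X order_refl] in \<open>metis restrict_apply'\<close>)
  next
    fix g assume g: "g \<in> words s \<Gamma> \<rightarrow>\<^sub>E words s \<Gamma> \<and>
      (AE \<omega> in M. joint {1..s} Y \<omega> = g (joint {1..s} X \<omega>))"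
    then have "AE \<omega> in M. g (joint {1..s} X \<omega>) = f (joint {1..s} X \<omega>)"
      using f by auto
    then have "g x = f x" if "x \<in> words s \<Gamma>" for x
      by (rule full_support_AE_imp_all[OF M supp, where Q = "\<lambda>x. g x = f x"]) fact+
    then show "g = restrict f (words s \<Gamma>)"
      using g by (intro extensionalityI[of _ "words s \<Gamma>"]) (auto simp: PiE_def)
  qed
qed

section \<open>Unbiased arrays and all-or-nothing maps\<close>

text \<open>
  With \<open>v^s\<close> rows and \<open>s\<close> columns, the prescribed number of occurrences is \<open>v^s / v^s = 1\<close>.
\<close>

lemma ex1_row_if_unbiased:
  assumes A: "is_array (v ^ s) (2 * s) v \<Gamma> A" and "1 \<le> v"
    and "unbiased \<Gamma> A D" and "card D = s" and "u \<in> D \<rightarrow>\<^sub>E \<Gamma>"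
  shows "\<exists>!r. r \<in># A \<and> restrict r D = u"
proof -
  have "real (count (keep_columns A D) u) = 1"
    using assms by (simp add: unbiased_def is_array_def)
  then have "size {#r \<in># A. restrict r D = u#} = 1"
    by (simp add: keep_columns_def count_conv_size_mset filter_mset_image_mset eq_commute)
  then obtain r where "{#r \<in># A. restrict r D = u#} = {#r#}"
    using size_1_singleton_mset by blast
  then have "{r. r \<in># A \<and> restrict r D = u} = {r}"
    using set_mset_filter[of "\<lambda>r. restrict r D = u" A] by simp
  then show ?thesis by (intro ex1I[of _ r]) blast+
qed

text \<open>
  A surjection between finite sets of equal size is a bijection, so attaining every tuple already
  means attaining each of them exactly once.
\<close>

lemma unbiased_image_mset_set:
  assumes "finite \<Gamma>" "1 \<le> card \<Gamma>" and W: "finite W" "card W = card \<Gamma> ^ card D" and "finite D"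
    and sub: "D \<rightarrow>\<^sub>E \<Gamma> \<subseteq> (\<lambda>x. restrict (g x) D) ` W"
  shows "unbiased \<Gamma> (image_mset g (mset_set W)) D"
proof -
  let ?f = "\<lambda>x. restrict (g x) D"
  have card_eq: "card (D \<rightarrow>\<^sub>E \<Gamma>) = card W"
    using W \<open>finite D\<close> by (simp add: card_PiE)
  have "card (?f ` W) \<le> card W" using W by (rule_tac card_image_le)
  then have img: "?f ` W = D \<rightarrow>\<^sub>E \<Gamma>"
    using card_seteq[OF finite_imageI[OF W(1)] sub] card_eq by simp
  then have inj: "inj_on ?f W"
    using W card_eq by (intro eq_card_imp_inj_on) auto
  have "count (keep_columns (image_mset g (mset_set W)) D) u = 1" if "u \<in> D \<rightarrow>\<^sub>E \<Gamma>" for u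
  proof -
    have "keep_columns (image_mset g (mset_set W)) D = mset_set (D \<rightarrow>\<^sub>E \<Gamma>)"
      using inj img by (simp add: keep_columns_def multiset.map_comp comp_def image_mset_mset_set)
    then show ?thesis
      using that \<open>finite D\<close> \<open>finite \<Gamma>\<close> by (simp add: finite_PiE)
  qed
  then show ?thesis
    using W assms(2) by (simp add: unbiased_def)
qed

text \<open>
  The outputs are numbered \<open>1, \<dots>, s\<close> as random variables but \<open>s+1, \<dots>, 2s\<close> as columns.
\<close>

lemma shifted_columns:
  assumes "J \<subseteq> {s+1..2 * (s::nat)}"
  obtains J' where "J' \<subseteq> {1..s}" "J = (+) s ` J'" "card J' = card J"
proof
  let ?J' = "(\<lambda>j. j - s) ` J"
  show "?J' \<subseteq> {1..s}" using assms by fastforce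
  show eq: "J = (+) s ` ?J'" using assms by (force simp: image_image)
  show "card ?J' = card J"
    using assms by (intro card_image inj_on_diff_nat) auto
qed

lemma join_halves_shifted:
  assumes u: "restrict x I = restrict r I" and I: "I \<subseteq> {1..s}" and J: "J \<subseteq> {1..s}"
    and w: "restrict y J = restrict (\<lambda>j. r (s + j)) J"
  shows "restrict (join_halves s x y) (I \<union> (+) s ` J) = restrict r (I \<union> (+) s ` J)"
proof
  fix c
  have "x c = r c" if "c \<in> I" using fun_cong[OF u, of c] that by simp
  moreover have "y j = r (s + j)" if "j \<in> J" for j using fun_cong[OF w, of j] that by simp
  ultimately show "restrict (join_halves s x y) (I \<union> (+) s ` J) c = restrict r (I \<union> (+) s ` J) c"
    using I J by (fastforce simp: join_halves_def restrict_def)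
qed

text \<open>
  All three kinds of column sets have the form \<open>I \<union> (s + J)\<close> with \<open>card I + card J = s\<close>: the halves
  are the cases \<open>J = {}\<close> and \<open>I = {}\<close>, where attaining all tuples is trivial and the
  surjectivity of \<open>\<phi>\<close>, respectively.
\<close>

lemma array_representation_unbiased:
  assumes "finite \<Gamma>" "1 \<le> card \<Gamma>" "t \<le> s" and \<phi>: "AONT_map t s \<Gamma> \<phi>"
  shows "is_array (card \<Gamma> ^ s) (2 * s) (card \<Gamma>) \<Gamma> (array_representation s \<Gamma> \<phi>)"
    and "unbiased_AONT_columns t s \<Gamma> (array_representation s \<Gamma> \<phi>)"
proof -
  have bij: "bij_betw \<phi> (words s \<Gamma>) (words s \<Gamma>)"
    using \<phi> by (simp add: AONT_map_def)
  have fin: "finite (words s \<Gamma>)" and card: "card (words s \<Gamma>) = card \<Gamma> ^ s"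
    using \<open>finite \<Gamma>\<close> by (simp_all add: finite_PiE card_PiE)
  have "join_halves s x (\<phi> x) \<in> words (2 * s) \<Gamma>" if "x \<in> words s \<Gamma>" for x
  proof -
    have "\<phi> x \<in> words s \<Gamma>" using bij that by (auto dest: bij_betwE)
    moreover have "c - s \<in> {1..s}" if "c \<in> {1..2 * s}" "\<not> c \<le> s" for c
      using that by auto
    ultimately show ?thesis
      using that unfolding join_halves_def restrict_PiE_iff by (auto simp: PiE_iff)
  qed
  then show "is_array (card \<Gamma> ^ s) (2 * s) (card \<Gamma>) \<Gamma> (array_representation s \<Gamma> \<phi>)"
    using fin card \<open>finite \<Gamma>\<close> by (auto simp: is_array_def array_representation_def)
  have unb: "unbiased \<Gamma> (array_representation s \<Gamma> \<phi>) (I \<union> (+) s ` J)"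
    if I: "I \<subseteq> {1..s}" and J: "J \<subseteq> {1..s}" and c: "card I + card J = s"
      and hit: "\<And>u w. u \<in> I \<rightarrow>\<^sub>E \<Gamma> \<Longrightarrow> w \<in> J \<rightarrow>\<^sub>E \<Gamma> \<Longrightarrow>
        \<exists>x \<in> words s \<Gamma>. restrict x I = u \<and> restrict (\<phi> x) J = w" for I J
    unfolding array_representation_def
  proof (rule unbiased_image_mset_set)
    have fIJ: "finite I" "finite J" using I J by (auto intro: finite_subset)
    have "I \<inter> (+) s ` J = {}" using I J by fastforce
    then have "card (I \<union> (+) s ` J) = s"
      using c fIJ by (simp add: card_Un_disjoint card_image)
    then show "card (words s \<Gamma>) = card \<Gamma> ^ card (I \<union> (+) s ` J)" using card by simp
    show "finite (I \<union> (+) s ` J)" using fIJ by simp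
    show "(I \<union> (+) s ` J) \<rightarrow>\<^sub>E \<Gamma> \<subseteq> (\<lambda>x. restrict (join_halves s x (\<phi> x)) (I \<union> (+) s ` J)) ` words s \<Gamma>"
    proof
      fix r assume r: "r \<in> (I \<union> (+) s ` J) \<rightarrow>\<^sub>E \<Gamma>"
      then have "restrict r I \<in> I \<rightarrow>\<^sub>E \<Gamma>" "restrict (\<lambda>j. r (s + j)) J \<in> J \<rightarrow>\<^sub>E \<Gamma>"
        by auto
      from hit[OF this] obtain x where "x \<in> words s \<Gamma>" "restrict x I = restrict r I"
        "restrict (\<phi> x) J = restrict (\<lambda>j. r (s + j)) J" by blast
      then have "restrict (join_halves s x (\<phi> x)) (I \<union> (+) s ` J) = r"
        using join_halves_shifted[OF _ I J] PiE_restrict[OF r] by metis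
      with \<open>x \<in> words s \<Gamma>\<close> show "r \<in> (\<lambda>x. restrict (join_halves s x (\<phi> x)) (I \<union> (+) s ` J)) ` words s \<Gamma>"
        by blast
    qed
  qed (use assms fin in auto)
  have restr: "restrict x {1..s} = x" if "x \<in> words s \<Gamma>" for x
    using that by (rule PiE_restrict)
  have "unbiased \<Gamma> (array_representation s \<Gamma> \<phi>) ({1..s} \<union> (+) s ` {})"
  proof (rule unb)
    fix u w assume u: "u \<in> words s \<Gamma>" and w: "w \<in> ({} :: nat set) \<rightarrow>\<^sub>E \<Gamma>"
    have "restrict (\<phi> u) {} = w" using w by (simp add: restrict_def)
    then show "\<exists>x \<in> words s \<Gamma>. restrict x {1..s} = u \<and> restrict (\<phi> x) {} = w"
      using restr[OF u] u by (intro bexI[of _ u] conjI)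
  qed auto
  moreover have "unbiased \<Gamma> (array_representation s \<Gamma> \<phi>) ({} \<union> (+) s ` {1..s})"
  proof (rule unb)
    fix u w assume u: "u \<in> ({} :: nat set) \<rightarrow>\<^sub>E \<Gamma>" and w: "w \<in> words s \<Gamma>"
    have "w \<in> \<phi> ` words s \<Gamma>" unfolding bij_betw_imp_surj_on[OF bij] by fact
    then obtain x where x: "x \<in> words s \<Gamma>" "\<phi> x = w" by (metis imageE)
    have "restrict x {} = u" using u by (simp add: restrict_def)
    moreover have "restrict (\<phi> x) {1..s} = w" using restr[OF w] x by simp
    ultimately show "\<exists>x \<in> words s \<Gamma>. restrict x {} = u \<and> restrict (\<phi> x) {1..s} = w"
      using x(1) by (intro bexI[of _ x] conjI)
  qed auto
  moreover have "(+) s ` {1..s} = {s+1..2 * s}"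
    by (simp add: image_add_atLeastAtMost mult_2)
  moreover have "unbiased \<Gamma> (array_representation s \<Gamma> \<phi>) (I \<union> J)"
    if I: "I \<subseteq> {1..s}" "card I = t" and J: "J \<subseteq> {s+1..2 * s}" "card J = s - t" for I J
  proof -
    obtain J' where J': "J' \<subseteq> {1..s}" "J = (+) s ` J'" "card J' = card J"
      using shifted_columns[OF J(1)] .
    have "unbiased \<Gamma> (array_representation s \<Gamma> \<phi>) (I \<union> (+) s ` J')"
    proof (rule unb)
      show "card I + card J' = s" using I J J' \<open>t \<le> s\<close> by simp
      show "\<exists>x \<in> words s \<Gamma>. restrict x I = u \<and> restrict (\<phi> x) J' = w"
        if "u \<in> I \<rightarrow>\<^sub>E \<Gamma>" "w \<in> J' \<rightarrow>\<^sub>E \<Gamma>" for u w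
        using that \<phi> I J J' unfolding AONT_map_def by metis
    qed fact+
    with J' show ?thesis by simp
  qed
  ultimately show "unbiased_AONT_columns t s \<Gamma> (array_representation s \<Gamma> \<phi>)"
    unfolding unbiased_AONT_columns_def by (simp add: mult_2)
qed

lemma left_half_in_words: "r \<in> words (2 * s) \<Gamma> \<Longrightarrow> left_half s r \<in> words s \<Gamma>"
  by (auto simp: left_half_def)

lemma right_half_in_words: "r \<in> words (2 * s) \<Gamma> \<Longrightarrow> right_half s r \<in> words s \<Gamma>"
  by (auto simp: right_half_def)

lemma restrict_right_columns_eq_if_right_half_eq:
  assumes "right_half s r = right_half s r'"
  shows "restrict r {s+1..2 * s} = restrict r' {s+1..2 * s}"
proof
  fix c
  have "r c = r' c" if "c \<in> {s+1..2 * s}"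
    using fun_cong[OF assms, of "c - s"] that by (auto simp: right_half_def split: if_splits)
  then show "restrict r {s+1..2 * s} c = restrict r' {s+1..2 * s} c" by simp
qed

lemma ex1_left_half_if_unbiased:
  assumes A: "is_array (v ^ s) (2 * s) v \<Gamma> A" and "1 \<le> v"
    and "unbiased_AONT_columns t s \<Gamma> A" and "x \<in> words s \<Gamma>"
  shows "\<exists>!r. r \<in># A \<and> left_half s r = x"
  using ex1_row_if_unbiased[OF A \<open>1 \<le> v\<close>, of "{1..s}" x] assms(3,4)
  by (simp add: unbiased_AONT_columns_def left_half_def)

lemma ex1_map_of_unbiased_array:
  assumes A: "is_array (v ^ s) (2 * s) v \<Gamma> A" and "1 \<le> v"
    and unb: "unbiased_AONT_columns t s \<Gamma> A"
  shows "\<exists>!\<phi>. \<phi> \<in> words s \<Gamma> \<rightarrow>\<^sub>E words s \<Gamma> \<and> (\<forall>r\<in>#A. \<phi> (left_half s r) = right_half s r)"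
proof -
  have rows: "r \<in> words (2 * s) \<Gamma>" if "r \<in># A" for r
    using A that by (auto simp: is_array_def)
  define row_of where "row_of x = (THE r. r \<in># A \<and> left_half s r = x)" for x
  have row_of: "row_of x \<in># A \<and> left_half s (row_of x) = x" if "x \<in> words s \<Gamma>" for x
    unfolding row_of_def by (rule theI'[OF ex1_left_half_if_unbiased[OF assms that]])
  have row_left: "row_of (left_half s r) = r" if "r \<in># A" for r
  proof -
    have x: "left_half s r \<in> words s \<Gamma>" by (rule left_half_in_words[OF rows[OF that]])
    from ex1_left_half_if_unbiased[OF assms x] row_of[OF x] that show ?thesis by blast
  qed
  define \<phi> where "\<phi> = (\<lambda>x\<in>words s \<Gamma>. right_half s (row_of x))"
  show ?thesis
  proof (rule ex1I[of _ \<phi>], intro conjI ballI)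
    show "\<phi> \<in> words s \<Gamma> \<rightarrow>\<^sub>E words s \<Gamma>"
      unfolding \<phi>_def restrict_PiE_iff
    proof
      fix x assume "x \<in> words s \<Gamma>"
      then have "row_of x \<in># A" using row_of by blast
      then show "right_half s (row_of x) \<in> words s \<Gamma>" by (intro right_half_in_words rows)
    qed
    show "\<phi> (left_half s r) = right_half s r" if "r \<in># A" for r
      using left_half_in_words[OF rows[OF that]] row_left[OF that] by (simp add: \<phi>_def)
  next
    fix g assume g: "g \<in> words s \<Gamma> \<rightarrow>\<^sub>E words s \<Gamma> \<and> (\<forall>r\<in>#A. g (left_half s r) = right_half s r)"
    then have "g x = right_half s (row_of x)" if "x \<in> words s \<Gamma>" for x
      using row_of[OF that] by metis
    with g show "g = \<phi>"
      unfolding \<phi>_def by (intro extensionalityI[of _ "words s \<Gamma>"]) (auto simp: PiE_def)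
  qed
qed

text \<open>
  Two words with the same image give two rows with the same right half, hence the same row. For
  the values prescribed on \<open>I\<close> and \<open>J\<close>, the left half of the row that shows them in the columns
  \<open>I \<union> (s + J)\<close> is the required word.
\<close>

lemma AONT_map_if_unbiased_array:
  assumes A: "is_array (v ^ s) (2 * s) v \<Gamma> A" and "1 \<le> v" "t \<le> s"
    and unb: "unbiased_AONT_columns t s \<Gamma> A"
    and \<phi>: "\<phi> \<in> words s \<Gamma> \<rightarrow> words s \<Gamma>"
    and \<phi>_rows: "\<And>r. r \<in># A \<Longrightarrow> \<phi> (left_half s r) = right_half s r"
  shows "AONT_map t s \<Gamma> \<phi>"
proof -
  have rows: "r \<in> words (2 * s) \<Gamma>" if "r \<in># A" for r
    using A that by (auto simp: is_array_def)
  have "finite \<Gamma>" using A by (simp add: is_array_def)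
  have "inj_on \<phi> (words s \<Gamma>)"
  proof (rule inj_onI)
    fix x x' assume x: "x \<in> words s \<Gamma>" and x': "x' \<in> words s \<Gamma>" and eq: "\<phi> x = \<phi> x'"
    obtain r where r: "r \<in># A" "left_half s r = x"
      using ex1_left_half_if_unbiased[OF A \<open>1 \<le> v\<close> unb x] by blast
    obtain r' where r': "r' \<in># A" "left_half s r' = x'"
      using ex1_left_half_if_unbiased[OF A \<open>1 \<le> v\<close> unb x'] by blast
    have same: "restrict r {s+1..2 * s} = restrict r' {s+1..2 * s}"
      using \<phi>_rows[OF r(1)] \<phi>_rows[OF r'(1)] r r' eq
      by (intro restrict_right_columns_eq_if_right_half_eq) simp
    have "restrict r {s+1..2 * s} \<in> {s+1..2 * s} \<rightarrow>\<^sub>E \<Gamma>"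
      using rows[OF r(1)] by auto
    then have "\<exists>!q. q \<in># A \<and> restrict q {s+1..2 * s} = restrict r {s+1..2 * s}"
      using unb by (intro ex1_row_if_unbiased[OF A \<open>1 \<le> v\<close>]) (auto simp: unbiased_AONT_columns_def)
    then have "r = r'" using r(1) r'(1) same by metis
    then show "x = x'" using r r' by simp
  qed
  moreover from this have "\<phi> ` words s \<Gamma> = words s \<Gamma>"
    using \<phi> \<open>finite \<Gamma>\<close> by (intro endo_inj_surj) (auto simp: finite_PiE)
  ultimately have "bij_betw \<phi> (words s \<Gamma>) (words s \<Gamma>)" by (simp add: bij_betw_def)
  moreover have "\<exists>x \<in> words s \<Gamma>. restrict x I = u \<and> restrict (\<phi> x) J = w"
    if I: "I \<subseteq> {1..s}" and J: "J \<subseteq> {1..s}" and c: "card I = t" "card J = s - t"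
      and u: "u \<in> I \<rightarrow>\<^sub>E \<Gamma>" and w: "w \<in> J \<rightarrow>\<^sub>E \<Gamma>" for I J u w
  proof -
    let ?D = "I \<union> (+) s ` J"
    define q where "q = (\<lambda>c\<in>?D. if c \<le> s then u c else w (c - s))"
    have "finite I" "finite J" using I J by (auto intro: finite_subset)
    moreover have "I \<inter> (+) s ` J = {}" using I J by fastforce
    ultimately have "card ?D = s" using c \<open>t \<le> s\<close> by (simp add: card_Un_disjoint card_image)
    moreover have "unbiased \<Gamma> A ?D"
    proof -
      have "(+) s ` J \<subseteq> {s+1..2 * s}" using J by fastforce
      moreover have "card ((+) s ` J) = s - t" using c by (simp add: card_image)
      ultimately show ?thesis using unb I c unfolding unbiased_AONT_columns_def by blast
    qed
    moreover have "q \<in> ?D \<rightarrow>\<^sub>E \<Gamma>"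
      using I J u w by (fastforce simp: q_def)
    ultimately obtain r where r: "r \<in># A" "restrict r ?D = q"
      using ex1_row_if_unbiased[OF A \<open>1 \<le> v\<close>] by blast
    have rI: "r i = u i" if "i \<in> I" for i
      using fun_cong[OF r(2), of i] that I by (auto simp: q_def)
    have rJ: "r (s + j) = w j" if "j \<in> J" for j
      using fun_cong[OF r(2), of "s + j"] that J by (auto simp: q_def)
    have "restrict (left_half s r) I = u"
      using I rI u by (intro extensionalityI[of _ I]) (auto simp: left_half_def PiE_def)
    moreover have "restrict (\<phi> (left_half s r)) J = w"
      using J rJ w
      by (intro extensionalityI[of _ J]) (auto simp: \<phi>_rows[OF r(1)] right_half_def PiE_def)
    ultimately show ?thesis using left_half_in_words[OF rows[OF r(1)]] by blast
  qed
  ultimately show ?thesis unfolding AONT_map_def by blast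
qed

section \<open>The equivalence\<close>

theorem theorem2p1:
  fixes t s v :: nat and \<Gamma> :: "'a set"
  assumes "1 \<le> t" and "t \<le> s"
    and "finite \<Gamma>" and "card \<Gamma> = v" and "1 \<le> v"
  shows
    "(\<forall>A :: 'a array.
        is_array (v ^ s) (2 * s) v \<Gamma> A \<and> unbiased_AONT_columns t s \<Gamma> A \<longrightarrow>
          (\<exists>!\<phi>. \<phi> \<in> words s \<Gamma> \<rightarrow>\<^sub>E words s \<Gamma> \<and>
                (\<forall>r\<in>#A. \<phi> (left_half s r) = right_half s r)) \<and>
          (\<forall>\<phi> \<in> words s \<Gamma> \<rightarrow> words s \<Gamma>.
             (\<forall>r\<in>#A. \<phi> (left_half s r) = right_half s r) \<longrightarrow>
             (\<forall>(M :: 'w measure) X Y.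
                prob_space M \<and> random_word M s \<Gamma> X \<and> full_support M s \<Gamma> X \<and>
                (\<forall>\<omega>\<in>space M. joint {1..s} Y \<omega> = \<phi> (joint {1..s} X \<omega>)) \<longrightarrow>
                weakly_secure_AONT t s \<Gamma> M X Y)))
     \<and>
     (\<forall>(M :: 'w measure) (X :: nat \<Rightarrow> 'w \<Rightarrow> 'a) Y.
        weakly_secure_AONT t s \<Gamma> M X Y \<and> full_support M s \<Gamma> X \<longrightarrow>
          (\<exists>!\<phi>. \<phi> \<in> words s \<Gamma> \<rightarrow>\<^sub>E words s \<Gamma> \<and>
                (AE \<omega> in M. joint {1..s} Y \<omega> = \<phi> (joint {1..s} X \<omega>))) \<and>
          (\<forall>\<phi> \<in> words s \<Gamma> \<rightarrow> words s \<Gamma>.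
             (AE \<omega> in M. joint {1..s} Y \<omega> = \<phi> (joint {1..s} X \<omega>)) \<longrightarrow>
             is_array (v ^ s) (2 * s) v \<Gamma> (array_representation s \<Gamma> \<phi>) \<and>
             unbiased_AONT_columns t s \<Gamma> (array_representation s \<Gamma> \<phi>)))"
proof (intro conjI allI ballI impI; (elim conjE)?)
  fix A :: "'a array"
  assume A: "is_array (v ^ s) (2 * s) v \<Gamma> A" and unb: "unbiased_AONT_columns t s \<Gamma> A"
  show "\<exists>!\<phi>. \<phi> \<in> words s \<Gamma> \<rightarrow>\<^sub>E words s \<Gamma> \<and> (\<forall>r\<in>#A. \<phi> (left_half s r) = right_half s r)"
    by (rule ex1_map_of_unbiased_array[OF A \<open>1 \<le> v\<close> unb])
  fix \<phi> and M :: "'w measure" and X Y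
  assume "\<phi> \<in> words s \<Gamma> \<rightarrow> words s \<Gamma>" "\<forall>r\<in>#A. \<phi> (left_half s r) = right_half s r"
  then have "AONT_map t s \<Gamma> \<phi>"
    by (intro AONT_map_if_unbiased_array[OF A \<open>1 \<le> v\<close> \<open>t \<le> s\<close> unb]) auto
  moreover assume "prob_space M" "random_word M s \<Gamma> X" "full_support M s \<Gamma> X"
    "\<forall>\<omega>\<in>space M. joint {1..s} Y \<omega> = \<phi> (joint {1..s} X \<omega>)"
  ultimately show "weakly_secure_AONT t s \<Gamma> M X Y"
    using \<open>finite \<Gamma>\<close> by (intro weakly_secure_AONT_if_AONT_map) auto
next
  fix M :: "'w measure" and X Y :: "nat \<Rightarrow> 'w \<Rightarrow> 'a"
  assume aont: "weakly_secure_AONT t s \<Gamma> M X Y" and supp: "full_support M s \<Gamma> X"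
  show "\<exists>!\<phi>. \<phi> \<in> words s \<Gamma> \<rightarrow>\<^sub>E words s \<Gamma> \<and>
      (AE \<omega> in M. joint {1..s} Y \<omega> = \<phi> (joint {1..s} X \<omega>))"
    by (rule ex1_induced_map[OF \<open>finite \<Gamma>\<close> aont supp])
  fix \<phi>
  assume "\<phi> \<in> words s \<Gamma> \<rightarrow> words s \<Gamma>"
    "AE \<omega> in M. joint {1..s} Y \<omega> = \<phi> (joint {1..s} X \<omega>)"
  then have "AONT_map t s \<Gamma> \<phi>"
    by (rule AONT_map_if_weakly_secure_AONT[OF \<open>finite \<Gamma>\<close> aont supp])
  then show "is_array (v ^ s) (2 * s) v \<Gamma> (array_representation s \<Gamma> \<phi>)"
    "unbiased_AONT_columns t s \<Gamma> (array_representation s \<Gamma> \<phi>)"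
    using array_representation_unbiased[of \<Gamma> t s \<phi>] assms by simp_all
qed

end
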